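(* Consider $m$ agents $i=1,\ldots,m$ with data and weight matrix $W$ as described in the context. Fix $\hat{\delta}>0$, an integer $T\ge1$, and a time $t\ge\max(t_1,t_2,t_3)$, where $t_1=8n+16\log\frac{2}{\hat\delta}$, $t_2=\left(\frac{16\hat{\mu}(\sqrt{4n}+\sqrt{2\log\frac{2}{\hat\delta}})}{\sigma_x}\right)^2$, $t_3=2(n+l)\log\frac{1}{\hat\delta}$. On the event $E_3$ defined in the context, for all $i\in\{1,\ldots,m\}$, $$\|\alpha^T_{i,t+1}-\bar\alpha_{t+1}\|\le m^{3/2}\sqrt{l}\,(\rho(W))^T\,(tc_1+\sqrt t\,c_2),$$ where $c_1=\|\Theta\|\big(\frac{19}{8}\sigma_x^2+\hat{\mu}^2\big)$ and $c_2=\sigma_\eta\Big(4\sigma_x\sqrt{(n+l)\log\frac{9}{\hat\delta}}+\hat{\mu}\big(\sqrt{2(l+n)}+\sqrt{2\log\frac{2}{\hat\delta}}\big)\Big)$.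
   Context: Data model: each agent $i\in\{1,\dots,m\}$ observes at times $j=1,2,\ldots$ pairs $(x_{i,j},y_{i,j})$ with $y_{i,j}=\Theta x_{i,j}+\eta_{i,j}$, $\Theta\in\mathbb{R}^{l\times n}$ unknown, $x_{i,j}\sim\mathcal{N}(\mu_{i,j},\sigma_x^2I_n)$, $\eta_{i,j}\sim\mathcal{N}(0,\sigma_\eta^2I_l)$, all mutually independent over time and agents, with deterministic means and $\sup_{i,j}\|\mu_{i,j}\|=\hat\mu<\infty$; $\sigma_x,\sigma_\eta>0$. The agents communicate over an undirected connected graph; $W\in\mathbb{R}^{m\times m}$ satisfies: $W(i,j)\ge0$, $W(i,j)=0$ if $j$ is not a neighbor of $i$ and $i\ne j$, $W\mathbf 1_m=\mathbf 1_m$, $W=W^*$, and $\rho(W)=\max\{\lambda_2(W),-\lambda_m(W)\}<1$, where $\lambda_1(W)\ge\lambda_2(W)\ge\cdots\ge\lambda_m(W)$ are the (real) eigenvalues of $W$. Define $\alpha_{i,t+1}=\sum_{j=1}^ty_{i,j}x_{i,j}^*$, $\bar\alpha_{t+1}=\frac1m\sum_{i=1}^m\alpha_{i,t+1}$, and the communicated quantities $\alpha^0_{i,t+1}=\alpha_{i,t+1}$, $\alpha^{k+1}_{i,t+1}=\sum_{j=1}^m W(i,j)\alpha^k_{j,t+1}$ for $k=0,\ldots,T-1$. Let $\bar{\mu}_{i,t}=\frac{4}{t\sigma_x^2}\sum_{j=1}^t\mu_{i,j}\mu_{i,j}^*$. The event $E_3$ is the intersection over all $i$ of $\{\|\sum_{j=1}^tx_{i,j}x_{i,j}^*\|\le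 t(\frac{19}{8}\sigma_x^2+\hat\mu^2)\}$, $\{\lambda_{\min}(\sum_{j=1}^tx_{i,j}x_{i,j}^* )\ge\frac{t\sigma_x^2}{8}\lambda_{\min}(I_n+\bar\mu_{i,t})\}$, and $\{\|\sum_{j=1}^t\eta_{i,j}x_{i,j}^*\|\le\sqrt t\,\sigma_\eta(4\sigma_x\sqrt{(n+l)\log\frac9{\hat\delta}}+\hat\mu(\sqrt{2(l+n)}+\sqrt{2\log\frac2{\hat\delta}}))\}$. $\|\cdot\|$ is the spectral norm, $A^*$ the transpose. *)

theory Defs
  imports "HOL-Analysis.Analysis" "HOL-Computational_Algebra.Polynomial"
begin

text \<open>Spectral norm (operator norm w.r.t. Euclidean norms) of a matrix.\<close>
definition specnorm :: "real^'n^'m \<Rightarrow> real" where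
  "specnorm A = onorm (\<lambda>v. A *v v)"

text \<open>Outer product u v^*.\<close>
definition outer :: "real^'m \<Rightarrow> real^'n \<Rightarrow> real^'n^'m" where
  "outer u v = (\<chi> a b. u$a * v$b)"

text \<open>Characteristic polynomial det(X I - A).\<close>
definition charpoly :: "real^'n^'n \<Rightarrow> real poly" where
  "charpoly A = det (\<chi> i j. (if i = j then [:0, 1:] else 0) - [:A$i$j:])"

text \<open>Real eigenvalues with algebraic multiplicity, sorted non-increasingly:
  eigs A ! 0 = lambda_1 >= eigs A ! 1 = lambda_2 >= ... (all eigenvalues are real
  for symmetric A).\<close>
definition eigs :: "real^'n^'n \<Rightarrow> real list" where
  "eigs A = rev (sorted_list_of_multiset (proots (charpoly A)))"

definition lambda_min :: "real^'n^'n \<Rightarrow> real" where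
  "lambda_min A = last (eigs A)"

text \<open>rho(W) = max(lambda_2(W), - lambda_m(W)).\<close>
definition rhoW :: "real^'n^'n \<Rightarrow> real" where
  "rhoW W = max (eigs W ! 1) (- last (eigs W))"

text \<open>Consensus iterates: alpha^0 = alpha, alpha^(k+1)_i = sum_j W(i,j) alpha^k_j.\<close>
fun cons_iter :: "real^'m^'m \<Rightarrow> ('m \<Rightarrow> real^'n^'l) \<Rightarrow> nat \<Rightarrow> 'm \<Rightarrow> real^'n^'l" where
  "cons_iter W a 0 i = a i"
| "cons_iter W a (Suc k) i = (\<Sum>j\<in>UNIV. W$i$j *\<^sub>R cons_iter W a k j)"

end

theory Submission
  imports Defs
begin

(* By symmetry of W, the consensus error is a weighted sum of the agents' data:
   alpha^T_i - alphabar = sum_j r_j alpha_j  with  r = W^T w  and  w = e_i - (1/m) 1.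
   The vector w is orthogonal to the all-ones vector, which is an eigenvector of W for the
   eigenvalue 1.  By the spectral theorem all other eigenvalues lie in [-rho(W), rho(W)], so W
   contracts the orthogonal complement of the all-ones vector by rho(W) and norm r <= rho(W)^T.
   On E_3 each alpha_j = Theta (sum x x^T) + sum eta x^T has spectral norm at most
   t c_1 + sqrt t c_2, so the error is at most
   (sum_j |r_j|) (t c_1 + sqrt t c_2) <= m rho(W)^T (t c_1 + sqrt t c_2),
   which is stronger than the claimed bound.  Since rho(W) is read off the sorted roots of the
   characteristic polynomial, the spectral theorem is used in the form
   charpoly W = prod_k (X - lambda_k). *)

lemma linear_coeff_eq_0_if_quadratic_nonneg:
  fixes b c :: real
  assumes "\<And>s. 0 \<le> b * s + c * s\<^sup>2"
  shows "b = 0"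
proof -
  define d where "d = \<bar>c\<bar> + 1"
  have d: "d > 0" unfolding d_def by simp
  have "0 \<le> b * (- b / d) + c * (- b / d)\<^sup>2" by (rule assms)
  also have "\<dots> \<le> b * (- b / d) + (d - 1) * (- b / d)\<^sup>2"
    unfolding d_def by (intro add_left_mono mult_right_mono) auto
  also have "\<dots> = - b\<^sup>2 / d\<^sup>2"
    using d by (simp add: field_simps power2_eq_square)
  finally have "b\<^sup>2 \<le> 0" using d by (simp add: divide_le_0_iff)
  then show ?thesis by simp
qed

lemma le_powr_three_halves_mult_sqrt:
  fixes x y :: real
  assumes "1 \<le> x" "1 \<le> y"
  shows "x \<le> x powr (3/2) * sqrt y"
proof -
  have "x = x powr 1" using assms by simp
  also have "\<dots> \<le> x powr (3/2)" using assms by (intro powr_mono) auto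
  also have "\<dots> \<le> x powr (3/2) * sqrt y" using assms by simp
  finally show ?thesis .
qed

section \<open>Symmetric matrices are orthogonally diagonalizable\<close>

lemma symmetric_matrix_inner:
  fixes A :: "real^'n^'n"
  assumes "transpose A = A"
  shows "(A *v x) \<bullet> y = x \<bullet> (A *v y)"
  by (metis assms dot_lmul_matrix vector_transpose_matrix)

lemma symmetric_rayleigh_maximizer_eigenvector:
  fixes A :: "real^'n^'n"
  assumes sym: "transpose A = A" and S: "subspace S" and inv: "\<And>x. x \<in> S \<Longrightarrow> A *v x \<in> S"
    and u: "u \<in> S" "u \<bullet> u = 1"
    and max: "\<And>v. v \<in> S \<Longrightarrow> v \<bullet> (A *v v) \<le> (u \<bullet> (A *v u)) * (v \<bullet> v)"
  shows "A *v u = (u \<bullet> (A *v u)) *\<^sub>R u"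
proof -
  define M where "M = u \<bullet> (A *v u)"
  define Q where "Q v = M * (v \<bullet> v) - v \<bullet> (A *v v)" for v
  define w where "w = M *\<^sub>R u - A *v u"
  have "w \<in> S" unfolding w_def using S u inv by (simp add: subspace_diff subspace_scale)
  have sym_uw: "u \<bullet> (A *v w) = w \<bullet> (A *v u)"
    using symmetric_matrix_inner[OF sym, of w u] by (simp add: inner_commute)
  have "w \<bullet> w = w \<bullet> (M *\<^sub>R u - A *v u)" by (simp add: w_def)
  then have ww: "w \<bullet> w = M * (u \<bullet> w) - w \<bullet> (A *v u)"
    by (simp add: inner_diff_right inner_commute)
  \<comment> \<open>Q is nonnegative on S and vanishes at u, so its derivative at u in direction w vanishes\<close>
  have "0 \<le> 2 * (w \<bullet> w) * s + Q w * s\<^sup>2" for s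
  proof -
    have "u + s *\<^sub>R w \<in> S" using S u \<open>w \<in> S\<close> by (simp add: subspace_add subspace_scale)
    then have "0 \<le> Q (u + s *\<^sub>R w)" using max unfolding Q_def M_def by simp
    also have "Q (u + s *\<^sub>R w) = 2 * (M * (u \<bullet> w) - w \<bullet> (A *v u)) * s + Q w * s\<^sup>2"
      using sym_uw u(2) unfolding Q_def M_def
      by (simp add: matrix_vector_right_distrib inner_add_left inner_add_right
          matrix_vector_mult_scaleR power2_eq_square algebra_simps inner_commute)
    finally show ?thesis by (simp only: ww)
  qed
  then have "2 * (w \<bullet> w) = 0" by (rule linear_coeff_eq_0_if_quadratic_nonneg)
  then show ?thesis unfolding w_def M_def by simp
qed

lemma symmetric_invariant_subspace_has_eigenvector:
  fixes A :: "real^'n^'n"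
  assumes sym: "transpose A = A" and S: "subspace S" and inv: "\<And>x. x \<in> S \<Longrightarrow> A *v x \<in> S"
    and nontriv: "x \<in> S" "x \<noteq> 0"
  obtains u where "u \<in> S" "u \<bullet> u = 1" "A *v u = (u \<bullet> (A *v u)) *\<^sub>R u"
proof -
  define K where "K = sphere 0 1 \<inter> S"
  have "compact K" unfolding K_def using S closed_subspace by (intro compact_Int_closed) auto
  moreover have "(1 / norm x) *\<^sub>R x \<in> K" unfolding K_def using nontriv S by (auto simp: subspace_scale)
  moreover have "continuous_on K (\<lambda>v. v \<bullet> (A *v v))"
    by (intro continuous_intros linear_continuous_on matrix_vector_mul_bounded_linear)
  ultimately obtain u where "u \<in> K" and umax: "\<And>v. v \<in> K \<Longrightarrow> v \<bullet> (A *v v) \<le> u \<bullet> (A *v u)"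
    using continuous_attains_sup[of K] by blast
  then have u: "u \<in> S" "u \<bullet> u = 1" unfolding K_def by (auto simp: dot_square_norm)
  have "v \<bullet> (A *v v) \<le> (u \<bullet> (A *v u)) * (v \<bullet> v)" if "v \<in> S" for v
  proof (cases "v = 0")
    case False
    define v' where "v' = (1 / norm v) *\<^sub>R v"
    have "v' \<in> K" unfolding K_def v'_def using False that S by (auto simp: subspace_scale)
    then have "v' \<bullet> (A *v v') \<le> u \<bullet> (A *v u)" by (rule umax)
    moreover have "v' \<bullet> (A *v v') = (v \<bullet> (A *v v)) / (v \<bullet> v)"
      unfolding v'_def by (simp add: matrix_vector_mult_scaleR dot_square_norm power2_eq_square)
    ultimately show ?thesis using False by (simp add: divide_le_eq)
  qed simp
  with that u show thesis by (metis symmetric_rayleigh_maximizer_eigenvector[OF sym S inv])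
qed

lemma symmetric_orthogonal_complement_invariant:
  fixes A :: "real^'n^'n"
  assumes sym: "transpose A = A" and eig: "A *v u = \<mu> *\<^sub>R u" and "orthogonal u y"
  shows "orthogonal u (A *v y)"
proof -
  have "u \<bullet> (A *v y) = (A *v u) \<bullet> y" using symmetric_matrix_inner[OF sym, of u y] by simp
  also have "\<dots> = 0" using assms(3) by (simp add: eig orthogonal_def)
  finally show ?thesis by (simp add: orthogonal_def)
qed

lemma symmetric_invariant_subspace_orthonormal_eigenbasis:
  fixes A :: "real^'n^'n"
  assumes sym: "transpose A = A"
  shows "subspace S \<Longrightarrow> (\<And>x. x \<in> S \<Longrightarrow> A *v x \<in> S) \<Longrightarrow>
    \<exists>B\<subseteq>S. pairwise orthogonal B \<and> (\<forall>b\<in>B. norm b = 1 \<and> (\<exists>\<mu>. A *v b = \<mu> *\<^sub>R b)) \<and> span B = S"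
proof (induction "dim S" arbitrary: S rule: less_induct)
  case less
  note S = less.prems(1) and inv = less.prems(2)
  show ?case
  proof (cases "S \<subseteq> {0}")
    case True
    then have "S = {0}" using S subspace_0 by blast
    then show ?thesis by (intro exI[of _ "{}"]) auto
  next
    case False
    then obtain x where "x \<in> S" "x \<noteq> 0" by auto
    then obtain u where u: "u \<in> S" "u \<bullet> u = 1" and eig: "A *v u = (u \<bullet> (A *v u)) *\<^sub>R u"
      using symmetric_invariant_subspace_has_eigenvector[OF sym S inv] by metis
    define S' where "S' = S \<inter> {y. orthogonal u y}"
    have S': "subspace S'" unfolding S'_def using S subspace_orthogonal_to_vector by (rule subspace_inter)
    have inv': "A *v y \<in> S'" if "y \<in> S'" for y
      using that inv symmetric_orthogonal_complement_invariant[OF sym eig] unfolding S'_def by blast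
    have "u \<notin> S'" unfolding S'_def using u by (auto simp: orthogonal_def)
    with u(1) have "S' \<subset> S" unfolding S'_def by blast
    then have "dim S' < dim S" using dim_psubset[of S' S] S S' by (metis span_eq_iff)
    then obtain B' where B': "B' \<subseteq> S'" "pairwise orthogonal B'"
       "\<forall>b\<in>B'. norm b = 1 \<and> (\<exists>\<mu>. A *v b = \<mu> *\<^sub>R b)" "span B' = S'"
      using less.hyps[OF _ S' inv'] by blast
    show ?thesis
    proof (intro exI[of _ "insert u B'"] conjI)
      show "insert u B' \<subseteq> S" using B'(1) u(1) unfolding S'_def by auto
      show "pairwise orthogonal (insert u B')"
        using B'(1,2) unfolding S'_def pairwise_insert by (auto simp: orthogonal_commute)
      show "\<forall>b\<in>insert u B'. norm b = 1 \<and> (\<exists>\<mu>. A *v b = \<mu> *\<^sub>R b)"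
        using B'(3) u(2) eig by (auto simp: norm_eq_1)
      have "v \<in> span (insert u B')" if "v \<in> S" for v
      proof -
        have "v - (u \<bullet> v) *\<^sub>R u \<in> S'" unfolding S'_def using that u S
          by (auto simp: orthogonal_def subspace_diff subspace_scale inner_diff_right)
        then show ?thesis unfolding span_insert B'(4) by auto
      qed
      moreover have "span (insert u B') \<subseteq> S"
        using B'(1) u(1) S unfolding S'_def by (intro span_minimal) auto
      ultimately show "span (insert u B') = S" by blast
    qed
  qed
qed

lemma symmetric_matrix_orthogonally_diagonalizable:
  fixes A :: "real^'n^'n"
  assumes sym: "transpose A = A"
  obtains P :: "real^'n^'n" and ev where "orthogonal_matrix P" "\<And>k. A *v column k P = ev k *\<^sub>R column k P"
proof -
  obtain B where B: "pairwise orthogonal B" "\<forall>b\<in>B. norm b = 1 \<and> (\<exists>\<mu>. A *v b = \<mu> *\<^sub>R b)"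
    "span B = UNIV"
    using symmetric_invariant_subspace_orthonormal_eigenbasis[OF sym, of UNIV] by auto
  then have "independent B" using pairwise_orthogonal_independent by fastforce
  then have "finite B" "card B = CARD('n)"
    using B(3) basis_card_eq_dim[of B UNIV] by (auto simp: finiteI_independent)
  then obtain f where f: "bij_betw f (UNIV :: 'n set) B"
    by (metis finite_class.finite_UNIV finite_same_card_bij)
  define P :: "real^'n^'n" where "P = (\<chi> i j. f j $ i)"
  have col: "column k P = f k" for k by (simp add: P_def column_def)
  have "f k \<in> B" for k using f by (auto simp: bij_betw_def)
  then have fk: "norm (f k) = 1 \<and> (\<exists>\<mu>. A *v f k = \<mu> *\<^sub>R f k)" for k using B(2) by blast
  moreover have "orthogonal (f i) (f j)" if "i \<noteq> j" for i j
    using B(1) f that by (auto simp: pairwise_def bij_betw_def inj_on_def)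
  ultimately have "orthogonal_matrix P"
    by (simp add: orthogonal_matrix_orthonormal_columns col)
  moreover have "A *v column k P = (SOME \<mu>. A *v f k = \<mu> *\<^sub>R f k) *\<^sub>R column k P" for k
    using fk[of k] unfolding col by (metis (mono_tags, lifting) someI_ex)
  ultimately show thesis by (rule that)
qed

lemma norm_orthogonal_matrix_mult:
  fixes P :: "real^'n^'n"
  assumes "orthogonal_matrix P"
  shows "norm (P *v x) = norm x"
proof -
  have "(P *v x) \<bullet> (P *v x) = x \<bullet> ((transpose P ** P) *v x)"
    by (metis dot_lmul_matrix matrix_vector_mul_assoc vector_transpose_matrix)
  also have "\<dots> = x \<bullet> x" using assms by (simp add: orthogonal_matrix_def)
  finally show ?thesis by (simp add: norm_eq_sqrt_inner)
qed

lemma orthogonal_matrix_column_expansion: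
  fixes P :: "real^'n^'n"
  assumes "orthogonal_matrix P"
  shows "(\<Sum>k\<in>UNIV. (column k P \<bullet> v) *\<^sub>R column k P) = v"
proof -
  have "(transpose P *v v) $ k = column k P \<bullet> v" for k
    by (simp add: matrix_vector_mult_def transpose_def column_def inner_vec_def)
  then have "(\<Sum>k\<in>UNIV. (column k P \<bullet> v) *\<^sub>R column k P) = P *v (transpose P *v v)"
    by (simp add: matrix_mult_sum scalar_mult_eq_scaleR)
  also have "\<dots> = (P ** transpose P) *v v" by (rule matrix_vector_mul_assoc)
  finally show ?thesis using assms by (simp add: orthogonal_matrix_def)
qed

lemma norm_le_if_orthogonal_eigenbasis:
  fixes A P :: "real^'n^'n"
  assumes P: "orthogonal_matrix P" and eig: "\<And>k. A *v column k P = ev k *\<^sub>R column k P"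
    and r: "0 \<le> r" and small: "\<And>k. column k P \<bullet> v = 0 \<or> \<bar>ev k\<bar> \<le> r"
  shows "norm (A *v v) \<le> r * norm v"
proof -
  define c where "c = (\<chi> k. column k P \<bullet> v)"
  have lincomb: "P *v y = (\<Sum>k\<in>UNIV. y $ k *\<^sub>R column k P)" for y
    by (simp add: matrix_mult_sum scalar_mult_eq_scaleR)
  have v: "v = P *v c"
    unfolding lincomb c_def using orthogonal_matrix_column_expansion[OF P] by simp
  have "A *v v = (\<Sum>k\<in>UNIV. c $ k *\<^sub>R (A *v column k P))"
    unfolding v lincomb by (simp add: linear_sum[OF matrix_vector_mul_linear] matrix_vector_mult_scaleR)
  also have "\<dots> = P *v (\<chi> k. ev k * c $ k)" unfolding lincomb by (simp add: eig mult.commute)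
  finally have "norm (A *v v) = norm (\<chi> k. ev k * c $ k)"
    by (simp add: norm_orthogonal_matrix_mult[OF P])
  also have "\<dots> \<le> norm (r *\<^sub>R c)"
  proof (intro norm_le_componentwise_cart)
    show "norm ((\<chi> k. ev k * c $ k) $ k) \<le> norm ((r *\<^sub>R c) $ k)" for k
      using small[of k] r by (auto simp: c_def abs_mult mult_right_mono)
  qed
  also have "\<dots> = r * norm v" using r by (simp add: v norm_orthogonal_matrix_mult[OF P])
  finally show ?thesis .
qed

section \<open>The characteristic polynomial and \<open>rhoW\<close>\<close>

lemma poly_charpoly: "poly (charpoly A) x = det (mat x - A)"
  unfolding charpoly_def det_def
  by (auto simp: poly_sum poly_prod mat_def of_int_poly intro!: sum.cong prod.cong)

lemma charpoly_orthogonally_diagonalizable: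
  fixes A P :: "real^'n^'n"
  assumes P: "orthogonal_matrix P" and eig: "\<And>k. A *v column k P = ev k *\<^sub>R column k P"
  shows "charpoly A = (\<Prod>k\<in>UNIV. [:- ev k, 1:])"
proof -
  have "det (mat x - A) = (\<Prod>k\<in>UNIV. x - ev k)" for x
  proof -
    define D :: "real^'n^'n" where "D = (\<chi> i j. if i = j then x - ev i else 0)"
    have AP: "(A ** P) $ i $ k = ev k * P $ i $ k" for i k
      using eig[of k] by (simp add: vec_eq_iff matrix_vector_mult_def matrix_matrix_mult_def column_def)
    have "((mat x - A) ** P) $ i $ k = (P ** D) $ i $ k" for i k
    proof -
      have "((mat x - A) ** P) $ i $ k = x * P $ i $ k - (A ** P) $ i $ k"
        by (simp add: matrix_matrix_mult_def mat_def left_diff_distrib sum_subtractf mult_delta_left)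
      also have "\<dots> = P $ i $ k * (x - ev k)" by (simp add: AP algebra_simps)
      also have "\<dots> = (P ** D) $ i $ k" by (simp add: D_def matrix_matrix_mult_def mult_delta_right)
      finally show ?thesis .
    qed
    then have "(mat x - A) ** P = P ** D" by (simp add: vec_eq_iff)
    then have "det (mat x - A) * det P = det P * det D" by (metis det_mul)
    moreover have "det P \<noteq> 0" using det_orthogonal_matrix[OF P] by auto
    ultimately have "det (mat x - A) = det D" by simp
    also have "\<dots> = (\<Prod>k\<in>UNIV. x - ev k)" unfolding D_def by (subst det_diagonal) auto
    finally show ?thesis .
  qed
  then show ?thesis
    by (intro poly_eq_poly_eq_iff[THEN iffD1]) (simp add: fun_eq_iff poly_charpoly poly_prod)
qed

lemma sorted_wrt_ge_last_le:
  fixes L :: "'a::linorder list"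
  assumes "sorted_wrt (\<ge>) L" "x \<in> set L"
  shows "last L \<le> x"
  using assms
proof (induction L)
  case (Cons y L)
  then show ?case by (cases "L = []") (auto intro: order_trans[of _ "last L"])
qed simp

lemma sorted_wrt_ge_nth_1_ge_min:
  fixes L :: "'a::linorder list"
  assumes sorted: "sorted_wrt (\<ge>) L" and ab: "{#a, b#} \<subseteq># mset L"
  shows "min a b \<le> L ! 1"
proof -
  have "size {#a, b#} \<le> size (mset L)" using ab by (rule size_mset_mono)
  then have "2 \<le> length L" by simp
  then obtain y z L' where L: "L = y # z # L'"
    by (cases L; cases "tl L") auto
  have "a \<in> set (z # L') \<or> b \<in> set (z # L')"
  proof (cases "a = y")
    case True
    then have "add_mset y {#b#} \<subseteq># add_mset y (mset (z # L'))" using ab L by simp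
    then show ?thesis by (simp add: mset_subset_eq_add_mset_cancel)
  next
    case False
    then show ?thesis using ab L by (auto dest: mset_subset_eqD)
  qed
  moreover have "w \<le> z" if "w \<in> set (z # L')" for w using sorted that L by auto
  ultimately show ?thesis using L by (auto simp: min_le_iff_disj)
qed

lemma mset_eigs: "mset (eigs A) = proots (charpoly A)"
  by (simp add: eigs_def)

lemma sorted_wrt_eigs: "sorted_wrt (\<ge>) (eigs A)"
  by (simp add: eigs_def sorted_wrt_rev)

lemma abs_eigenvalue_le_rhoW:
  fixes A :: "real^'n^'n" and ev :: "'k::finite \<Rightarrow> real"
  assumes spec: "proots (charpoly A) = image_mset ev (mset_set UNIV)"
    and k0: "ev k0 = 1" and rho: "rhoW A < 1" and k: "k \<noteq> k0"
  shows "\<bar>ev k\<bar> \<le> rhoW A"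
proof -
  have "{#ev k0, ev k#} = image_mset ev (mset_set {k0, k})" using k by simp
  also have "\<dots> \<subseteq># mset (eigs A)"
    unfolding mset_eigs spec by (intro image_mset_subseteq_mono) simp
  finally have "min 1 (ev k) \<le> eigs A ! 1"
    using sorted_wrt_ge_nth_1_ge_min[OF sorted_wrt_eigs] k0 by simp
  moreover have "ev k \<in> set (eigs A)"
    by (simp flip: set_mset_mset add: mset_eigs spec)
  then have "last (eigs A) \<le> ev k" by (rule sorted_wrt_ge_last_le[OF sorted_wrt_eigs])
  ultimately show ?thesis using rho unfolding rhoW_def by (auto simp: min_def split: if_splits)
qed

lemma stochastic_symmetric_contraction:
  fixes W :: "real^'m^'m"
  assumes card: "CARD('m) \<ge> 2" and sym: "transpose W = W" and one: "W *v 1 = 1"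
    and rho: "rhoW W < 1"
  shows "0 \<le> rhoW W" and "v \<bullet> 1 = 0 \<Longrightarrow> norm (W *v v) \<le> rhoW W * norm v"
proof -
  obtain P :: "real^'m^'m" and ev where P: "orthogonal_matrix P"
    and eig: "\<And>k. W *v column k P = ev k *\<^sub>R column k P"
    using symmetric_matrix_orthogonally_diagonalizable[OF sym] by blast
  have spec: "proots (charpoly W) = image_mset ev (mset_set UNIV)"
    by (simp add: charpoly_orthogonally_diagonalizable[OF P eig] proots_prod sum_unfold_sum_mset)
  have eig_one: "ev k * (column k P \<bullet> 1) = column k P \<bullet> 1" for k
    using symmetric_matrix_inner[OF sym, of "column k P" 1] by (simp add: eig one)
  \<comment> \<open>the all-ones vector has a nonzero coordinate in the eigenbasis, whose eigenvalue must be 1\<close>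
  have "\<exists>k0. column k0 P \<bullet> 1 \<noteq> 0"
  proof (rule ccontr)
    assume "\<nexists>k0. column k0 P \<bullet> 1 \<noteq> 0"
    then have "(1 :: real^'m) = 0" using orthogonal_matrix_column_expansion[OF P, of 1] by simp
    then show False by (simp add: vec_eq_iff)
  qed
  then obtain k0 where k0: "column k0 P \<bullet> 1 \<noteq> 0" ..
  then have "ev k0 = 1" using eig_one[of k0] by simp
  then have small: "\<bar>ev k\<bar> \<le> rhoW W" if "k \<noteq> k0" for k
    using abs_eigenvalue_le_rhoW[OF spec _ rho that] by simp
  obtain k1 :: 'm where "k1 \<noteq> k0"
  proof -
    have "\<not> UNIV \<subseteq> {k0}" using card card_mono[of "{k0}" UNIV] by auto
    then show thesis using that by blast
  qed
  then show rho0: "0 \<le> rhoW W" using small[of k1] by simp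
  assume v: "v \<bullet> 1 = 0"
  have "column k P \<bullet> 1 = 0" if "k \<noteq> k0" for k
    using eig_one[of k] small[OF that] rho by auto
  then have "(column k0 P \<bullet> 1) *\<^sub>R column k0 P = 1"
    using orthogonal_matrix_column_expansion[OF P, of 1] by (simp add: sum.remove[of UNIV k0])
  then have "(column k0 P \<bullet> 1) * (column k0 P \<bullet> v) = 0"
    using v by (metis inner_commute inner_scaleR_left)
  then have "column k0 P \<bullet> v = 0" using k0 by simp
  then show "norm (W *v v) \<le> rhoW W * norm v"
    using small by (intro norm_le_if_orthogonal_eigenbasis[OF P eig rho0]) (metis (full_types))
qed

section \<open>Spectral norm\<close>

lemma norm_matrix_vector_mult_le_specnorm: "norm (A *v v) \<le> specnorm A * norm v"
  unfolding specnorm_def by (rule onorm[OF matrix_vector_mul_bounded_linear])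

lemma specnorm_le: "(\<And>v. norm (A *v v) \<le> b * norm v) \<Longrightarrow> specnorm A \<le> b"
  unfolding specnorm_def by (rule onorm_le)

lemma specnorm_nonneg: "0 \<le> specnorm A"
  unfolding specnorm_def by (rule onorm_pos_le[OF matrix_vector_mul_bounded_linear])

lemma specnorm_add_le: "specnorm (A + B) \<le> specnorm A + specnorm B"
  unfolding specnorm_def matrix_vector_mult_add_rdistrib
  by (intro onorm_triangle matrix_vector_mul_bounded_linear)

lemma specnorm_matrix_mul_le: "specnorm (A ** B) \<le> specnorm A * specnorm B"
  unfolding specnorm_def matrix_vector_mul_assoc[symmetric]
  using onorm_compose[OF matrix_vector_mul_bounded_linear matrix_vector_mul_bounded_linear]
  by (simp add: comp_def)

lemma specnorm_sum_scaleR_le: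
  assumes "finite S" and "\<And>j. j \<in> S \<Longrightarrow> specnorm (M j) \<le> K"
  shows "specnorm (\<Sum>j\<in>S. c j *\<^sub>R M j) \<le> (\<Sum>j\<in>S. \<bar>c j\<bar>) * K"
proof (rule specnorm_le)
  fix v
  have "(\<Sum>j\<in>S. c j *\<^sub>R M j) *v v = (\<Sum>j\<in>S. c j *\<^sub>R (M j *v v))"
    using assms(1) by (induction S) (simp_all add: matrix_vector_mult_add_rdistrib scaleR_matrix_vector_assoc)
  then have "norm ((\<Sum>j\<in>S. c j *\<^sub>R M j) *v v) \<le> (\<Sum>j\<in>S. \<bar>c j\<bar> * norm (M j *v v))"
    by (simp add: norm_sum[THEN order_trans])
  also have "\<dots> \<le> (\<Sum>j\<in>S. \<bar>c j\<bar> * (K * norm v))"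
  proof (intro sum_mono mult_left_mono)
    fix j assume "j \<in> S"
    then show "norm (M j *v v) \<le> K * norm v"
      using norm_matrix_vector_mult_le_specnorm[of "M j" v] assms(2)[of j]
      by (meson mult_right_mono norm_ge_zero order_trans)
  qed simp
  finally show "norm ((\<Sum>j\<in>S. c j *\<^sub>R M j) *v v) \<le> (\<Sum>j\<in>S. \<bar>c j\<bar>) * K * norm v"
    by (simp add: sum_distrib_right mult.assoc)
qed

lemma sum_outer_linear_model:
  fixes Theta :: "real^'n^'l"
  shows "(\<Sum>j\<in>J. outer (Theta *v x j + eta j) (x j))
    = Theta ** (\<Sum>j\<in>J. outer (x j) (x j)) + (\<Sum>j\<in>J. outer (eta j) (x j))"
proof -
  have outer_model: "outer (Theta *v u + e) y = Theta ** outer u y + outer e y" for u e and y :: "real^'n"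
    by (simp add: vec_eq_iff outer_def matrix_vector_mult_def matrix_matrix_mult_def
        sum_distrib_left sum_distrib_right algebra_simps)
  have matrix_mul_sum: "Theta ** (\<Sum>j\<in>J. M j) = (\<Sum>j\<in>J. Theta ** M j)" for M :: "_ \<Rightarrow> real^'p^'n"
  proof (induction J rule: infinite_finite_induct)
    case (insert j J)
    then show ?case by (simp add: matrix_add_ldistrib)
  qed (simp_all add: vec_eq_iff matrix_matrix_mult_def)
  show ?thesis
    by (simp only: outer_model sum.distrib matrix_mul_sum)
qed

lemma specnorm_sum_outer_linear_model_le:
  fixes Theta :: "real^'n^'l"
  shows "specnorm (\<Sum>j\<in>J. outer (Theta *v x j + eta j) (x j))
    \<le> specnorm Theta * specnorm (\<Sum>j\<in>J. outer (x j) (x j)) + specnorm (\<Sum>j\<in>J. outer (eta j) (x j))"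
  unfolding sum_outer_linear_model
  using specnorm_add_le specnorm_matrix_mul_le by (rule order_trans[OF _ add_right_mono])

section \<open>Consensus iteration\<close>

lemma norm_funpow_le:
  fixes f :: "'a::real_normed_vector \<Rightarrow> 'a"
  assumes inv: "\<And>v. v \<in> S \<Longrightarrow> f v \<in> S" and contr: "\<And>v. v \<in> S \<Longrightarrow> norm (f v) \<le> r * norm v"
    and r: "0 \<le> r" and v: "v \<in> S"
  shows "norm ((f ^^ k) v) \<le> r ^ k * norm v"
proof -
  have "(f ^^ k) v \<in> S \<and> norm ((f ^^ k) v) \<le> r ^ k * norm v"
  proof (induction k)
    case (Suc k)
    then have "norm (f ((f ^^ k) v)) \<le> r * (r ^ k * norm v)"
      using contr r by (meson mult_left_mono order_trans)
    then show ?case using Suc inv by (simp add: mult.assoc)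
  qed (simp add: v)
  then show ?thesis ..
qed

lemma cons_iter_weighted_sum:
  fixes W :: "real^'m^'m"
  assumes sym: "transpose W = W"
  shows "(\<Sum>i\<in>UNIV. v $ i *\<^sub>R cons_iter W a k i) = (\<Sum>j\<in>UNIV. (((*v) W ^^ k) v) $ j *\<^sub>R a j)"
proof (induction k arbitrary: v)
  case (Suc k)
  have "(\<Sum>i\<in>UNIV. v $ i *\<^sub>R cons_iter W a (Suc k) i)
      = (\<Sum>i\<in>UNIV. \<Sum>j\<in>UNIV. (v $ i * W $ i $ j) *\<^sub>R cons_iter W a k j)"
    by (simp add: scaleR_sum_right)
  also have "\<dots> = (\<Sum>j\<in>UNIV. \<Sum>i\<in>UNIV. (v $ i * W $ i $ j) *\<^sub>R cons_iter W a k j)"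
    by (rule sum.swap)
  also have "\<dots> = (\<Sum>j\<in>UNIV. (\<Sum>i\<in>UNIV. v $ i * W $ i $ j) *\<^sub>R cons_iter W a k j)"
    by (simp add: scaleR_sum_left)
  also have "\<dots> = (\<Sum>j\<in>UNIV. (W *v v) $ j *\<^sub>R cons_iter W a k j)"
    using sym by (simp add: matrix_vector_mult_def vec_eq_iff transpose_def mult.commute)
  also have "\<dots> = (\<Sum>j\<in>UNIV. (((*v) W ^^ Suc k) v) $ j *\<^sub>R a j)"
    by (simp add: Suc funpow_Suc_right del: funpow.simps)
  finally show ?case .
qed simp

lemma cons_iter_minus_average:
  fixes W :: "real^'m^'m"
  assumes sym: "transpose W = W" and one: "W *v 1 = 1"
  shows "cons_iter W a k i - (1 / CARD('m)) *\<^sub>R (\<Sum>j\<in>UNIV. a j)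
    = (\<Sum>j\<in>UNIV. (((*v) W ^^ k) (axis i 1 - (1 / CARD('m)) *\<^sub>R 1)) $ j *\<^sub>R a j)"
proof -
  have "((*v) W ^^ k) 1 = 1" by (induction k) (simp_all add: one)
  then have average: "(\<Sum>i\<in>UNIV. cons_iter W a k i) = (\<Sum>j\<in>UNIV. a j)"
    using cons_iter_weighted_sum[OF sym, where v = 1 and a = a and k = k] by simp
  have "cons_iter W a k i - (1 / CARD('m)) *\<^sub>R (\<Sum>j\<in>UNIV. a j)
      = cons_iter W a k i - (1 / CARD('m)) *\<^sub>R (\<Sum>i'\<in>UNIV. cons_iter W a k i')"
    by (simp only: average)
  also have "\<dots> = (\<Sum>i'\<in>UNIV. (axis i 1 - (1 / CARD('m)) *\<^sub>R 1) $ i' *\<^sub>R cons_iter W a k i')"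
    by (simp add: scaleR_diff_left sum_subtractf axis_def scaleR_sum_right
        if_distrib[of "\<lambda>c. c *\<^sub>R _"] cong: if_cong)
  also have "\<dots> = (\<Sum>j\<in>UNIV. (((*v) W ^^ k) (axis i 1 - (1 / CARD('m)) *\<^sub>R 1)) $ j *\<^sub>R a j)"
    by (rule cons_iter_weighted_sum[OF sym])
  finally show ?thesis .
qed

lemma norm_consensus_weights_le:
  fixes W :: "real^'m^'m"
  assumes card: "CARD('m) \<ge> 2" and sym: "transpose W = W" and one: "W *v 1 = 1"
    and rho: "rhoW W < 1"
  shows "norm (((*v) W ^^ k) (axis i 1 - (1 / CARD('m)) *\<^sub>R 1)) \<le> rhoW W ^ k"
proof -
  define w :: "real^'m" where "w = axis i 1 - (1 / CARD('m)) *\<^sub>R 1"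
  have axis_one: "axis i 1 \<bullet> (1 :: real^'m) = 1" and one_one: "(1 :: real^'m) \<bullet> 1 = CARD('m)"
    by (simp_all add: inner_vec_def axis_def)
  have w1: "w \<bullet> 1 = 0"
    unfolding w_def by (simp only: inner_diff_left inner_scaleR_left axis_one one_one) simp
  have "w \<bullet> w = w \<bullet> axis i 1 - (1 / CARD('m)) * (w \<bullet> 1)"
    by (simp add: w_def inner_diff_right)
  also have "\<dots> = w $ i" by (simp add: w1 inner_axis)
  also have "\<dots> = 1 - 1 / CARD('m)" by (simp add: w_def)
  finally have "norm w \<le> 1" by (simp add: norm_eq_sqrt_inner)
  note rho0 = stochastic_symmetric_contraction(1)[OF card sym one rho]
  have "norm (((*v) W ^^ k) w) \<le> rhoW W ^ k * norm w"
  proof (rule norm_funpow_le[where S = "{v. v \<bullet> 1 = 0}"])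
    show "W *v v \<in> {v. v \<bullet> 1 = 0}" if "v \<in> {v. v \<bullet> 1 = 0}" for v
      using that symmetric_matrix_inner[OF sym, of v 1] by (simp add: one)
    show "norm (W *v v) \<le> rhoW W * norm v" if "v \<in> {v. v \<bullet> 1 = 0}" for v
      using that stochastic_symmetric_contraction(2)[OF card sym one rho] by simp
  qed (use w1 rho0 in auto)
  also have "\<dots> \<le> rhoW W ^ k" using \<open>norm w \<le> 1\<close> rho0 by (simp add: mult_left_le)
  finally show ?thesis unfolding w_def .
qed

lemma specnorm_consensus_error_le:
  fixes W :: "real^'m^'m" and a :: "'m \<Rightarrow> real^'n^'l"
  assumes card: "CARD('m) \<ge> 2" and sym: "transpose W = W" and one: "W *v 1 = 1"
    and rho: "rhoW W < 1" and bound: "\<And>j. specnorm (a j) \<le> K"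
  shows "specnorm (cons_iter W a k i - (1 / CARD('m)) *\<^sub>R (\<Sum>j\<in>UNIV. a j))
    \<le> CARD('m) * rhoW W ^ k * K"
proof -
  define r where "r = ((*v) W ^^ k) (axis i 1 - (1 / CARD('m)) *\<^sub>R 1)"
  have r: "norm r \<le> rhoW W ^ k" unfolding r_def by (rule norm_consensus_weights_le[OF card sym one rho])
  have K: "0 \<le> K" using bound[of i] specnorm_nonneg[of "a i"] by linarith
  have "specnorm (cons_iter W a k i - (1 / CARD('m)) *\<^sub>R (\<Sum>j\<in>UNIV. a j))
      = specnorm (\<Sum>j\<in>UNIV. r $ j *\<^sub>R a j)"
    by (simp add: cons_iter_minus_average[OF sym one] r_def)
  also have "\<dots> \<le> (\<Sum>j\<in>UNIV. \<bar>r $ j\<bar>) * K"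
    using bound by (intro specnorm_sum_scaleR_le) auto
  also have "\<dots> \<le> (\<Sum>j\<in>(UNIV :: 'm set). norm r) * K"
    using K by (intro mult_right_mono sum_mono component_le_norm_cart)
  also have "\<dots> \<le> CARD('m) * rhoW W ^ k * K"
    using r K by (simp add: mult_left_mono mult_right_mono)
  finally show ?thesis .
qed

theorem proposition2:
  fixes Theta :: "real^'n^'l"
    and W :: "real^'m^'m"
    and E :: "'m \<Rightarrow> 'm \<Rightarrow> bool"
    and x mu :: "'m \<Rightarrow> nat \<Rightarrow> real^'n"
    and eta :: "'m \<Rightarrow> nat \<Rightarrow> real^'l"
    and sigma_x sigma_eta mu_hat delta :: real
    and T t :: nat
  assumes m2: "CARD('m) \<ge> 2"
    and sx: "sigma_x > 0" and seta: "sigma_eta > 0"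
    and mu_bdd: "bdd_above {norm (mu i j) | i j. j \<ge> 1}"
    and mu_hat: "mu_hat = Sup {norm (mu i j) | i j. j \<ge> 1}"
    and E_sym: "\<And>i j. E i j \<longleftrightarrow> E j i"
    and E_irrefl: "\<And>i. \<not> E i i"
    and E_conn: "\<And>i j. (\<lambda>a b. E a b)\<^sup>*\<^sup>* i j"
    and W_nonneg: "\<And>i j. W$i$j \<ge> 0"
    and W_graph: "\<And>i j. i \<noteq> j \<Longrightarrow> \<not> E i j \<Longrightarrow> W$i$j = 0"
    and W_stoch: "\<And>i. (\<Sum>j\<in>UNIV. W$i$j) = 1"
    and W_sym: "transpose W = W"
    and W_rho: "rhoW W < 1"
    and delta: "delta > 0"
    and T: "T \<ge> 1"
    and t1: "real t \<ge> 8 * CARD('n) + 16 * ln (2 / delta)"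
    and t2: "real t \<ge> (16 * mu_hat * (sqrt (4 * CARD('n)) + sqrt (2 * ln (2 / delta))) / sigma_x)\<^sup>2"
    and t3: "real t \<ge> 2 * (CARD('n) + CARD('l)) * ln (1 / delta)"
    \<comment> \<open>the event E_3\<close>
    and E3_1: "\<And>i. specnorm (\<Sum>j=1..t. outer (x i j) (x i j))
                 \<le> t * (19/8 * sigma_x\<^sup>2 + mu_hat\<^sup>2)"
    and E3_2: "\<And>i. lambda_min (\<Sum>j=1..t. outer (x i j) (x i j))
                 \<ge> t * sigma_x\<^sup>2 / 8 *
                   lambda_min (mat 1 + (4 / (t * sigma_x\<^sup>2)) *\<^sub>R (\<Sum>j=1..t. outer (mu i j) (mu i j)))"
    and E3_3: "\<And>i. specnorm (\<Sum>j=1..t. outer (eta i j) (x i j))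
                 \<le> sqrt t * sigma_eta * (4 * sigma_x * sqrt ((CARD('n) + CARD('l)) * ln (9 / delta))
                     + mu_hat * (sqrt (2 * (CARD('l) + CARD('n))) + sqrt (2 * ln (2 / delta))))"
  shows "\<forall>i. specnorm
            (cons_iter W (\<lambda>i. \<Sum>j=1..t. outer (Theta *v x i j + eta i j) (x i j)) T i
             - (1 / CARD('m)) *\<^sub>R (\<Sum>k\<in>UNIV. \<Sum>j=1..t. outer (Theta *v x k j + eta k j) (x k j)))
         \<le> CARD('m) powr (3/2) * sqrt (CARD('l)) * (rhoW W) ^ T *
            (t * (specnorm Theta * (19/8 * sigma_x\<^sup>2 + mu_hat\<^sup>2))
             + sqrt t * (sigma_eta * (4 * sigma_x * sqrt ((CARD('n) + CARD('l)) * ln (9 / delta))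
                     + mu_hat * (sqrt (2 * (CARD('l) + CARD('n))) + sqrt (2 * ln (2 / delta)))))) "
proof -
  define a where "a k = (\<Sum>j=1..t. outer (Theta *v x k j + eta k j) (x k j))" for k
  define K where "K = t * (specnorm Theta * (19/8 * sigma_x\<^sup>2 + mu_hat\<^sup>2))
    + sqrt t * (sigma_eta * (4 * sigma_x * sqrt ((CARD('n) + CARD('l)) * ln (9 / delta))
        + mu_hat * (sqrt (2 * (CARD('l) + CARD('n))) + sqrt (2 * ln (2 / delta)))))"
  have bound: "specnorm (a k) \<le> K" for k
  proof -
    have "specnorm (a k) \<le> specnorm Theta * specnorm (\<Sum>j=1..t. outer (x k j) (x k j))
        + specnorm (\<Sum>j=1..t. outer (eta k j) (x k j))"
      unfolding a_def by (rule specnorm_sum_outer_linear_model_le)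
    also have "\<dots> \<le> K"
      unfolding K_def using mult_left_mono[OF E3_1[of k] specnorm_nonneg[of Theta]] E3_3[of k]
      by (intro add_mono) (simp_all add: mult.assoc mult.left_commute)
    finally show ?thesis .
  qed
  have one: "W *v 1 = 1" using W_stoch by (simp add: vec_eq_iff matrix_vector_mult_def)
  have "CARD('m) * rhoW W ^ T * K \<le> CARD('m) powr (3/2) * sqrt (CARD('l)) * rhoW W ^ T * K"
    using order_trans[OF specnorm_nonneg bound] stochastic_symmetric_contraction(1)[OF m2 W_sym one W_rho]
    by (intro mult_right_mono le_powr_three_halves_mult_sqrt) auto
  with specnorm_consensus_error_le[OF m2 W_sym one W_rho bound]
  have "specnorm (cons_iter W a T i - (1 / CARD('m)) *\<^sub>R (\<Sum>k\<in>UNIV. a k))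
      \<le> CARD('m) powr (3/2) * sqrt (CARD('l)) * rhoW W ^ T * K" for i
    by (rule order_trans)
  then show ?thesis unfolding a_def K_def by blast
qed

end
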